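(* Let $X$ be a quasi-Borel space and let $\mu,\nu\in TX$. Then $\mu$ decomposes uniquely as a sum of three (pairwise) mutually singular components $$\mu=\mu_a+\mu_\infty+\mu_s,$$ where $\mu_a,\mu_\infty,\mu_s\in TX$, $\mu_a\stackrel{\infty}{\ll}\nu$, $\mu_\infty$ is $\infty$-singular with respect to $\nu$, and $\mu_s$ and $\nu$ are mutually singular.
   Context: A quasi-Borel space (qbs) is a set $X$ with a set $M_X$ of functions $\mathbb{R}\to X$ (random elements) such that: all constant functions are in $M_X$; $M_X$ is closed under precomposition with Borel measurable functions $\mathbb{R}\to\mathbb{R}$; and if $\mathbb{R}=\biguplus_{i\in\mathbb{N}}U_i$ with $U_i$ Borel and $\alpha_i\in M_X$, then the function equal to $\alpha_i$ on $U_i$ for each $i$ is in $M_X$. A morphism $f:X\to Y$ is a function with $f\circ\alpha\in M_Y$ for all $\alpha\in M_X$; $\mathbf{Qbs}(X,Y)$ is the set of morphisms. A measurable space $\Omega$ (e.g. a standard Borel space, or $[0,\infty]$) is regarded as a qbs with $M_\Omega$ the set of measurable functions $\mathbb{R}\to\Omega$. A qbs $X$ carries the $\sigma$-algebra $\Sigma_X=\{U\subseteq X\mid\forall\alpha\in M_X,\ \alpha^{-1}(U)\text{ is Borel}\}$. A measure is s-finite if it is a countable sum of finite measures. The set $TX$ consists of triples $\langle\Omega,\mu,\alpha\rangle$, with $\Omega$ a standard Borel space, $\mu$ an s-finite measure on $\Omega$ and $\alpha\in\mathbf{Qbs}(\Omega,X)$, where two triples are identified when $\int_\Omega\mu(\mathrm{d}\omega)f(\alpha(\omega))=\int_{\Omega'}\mu'(\mathrm{d}\omega)f(\alpha'(\omega))$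 for all $f\in\mathbf{Qbs}(X,[0,\infty])$. The class of $\langle\Omega,\mu,\alpha\rangle$ is identified with the s-finite measure $\alpha_*\mu$ on $\Sigma_X$, so that $TX$ is a set of s-finite measures on $\Sigma_X$; elements of $TX$ are added as measures. For measures $m,n$ on $\Sigma_X$: $m$ and $n$ are mutually singular if there is $A\in\Sigma_X$ with $m(X\setminus A)=0=n(A)$; $m\ll n$ means every $n$-null set is $m$-null. A set $U\in\Sigma_X$ is an $m$-$0$-$\infty$-set if every $V\in\Sigma_X$ with $V\subseteq U$ satisfies $m(V)\in\{0,\infty\}$; it is trivial if $m(U)=0$. $m\stackrel{\infty}{\ll}n$ means that $m\ll n$ and every $n$-$0$-$\infty$-set is an $m$-$0$-$\infty$-set. $m$ is $\infty$-singular with respect to $n$ if $m\ll n$, all $m$-$0$-$\infty$-sets are trivial, and there is $A\in\Sigma_X$ with $m(X\setminus A)=0$ such that $A$ is an $n$-$0$-$\infty$-set. *)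

theory Defs
  imports "HOL-Analysis.Analysis"
begin

section \<open>Quasi-Borel spaces\<close>

definition is_quasi_borel :: "'a set \<Rightarrow> (real \<Rightarrow> 'a) set \<Rightarrow> bool" where
  "is_quasi_borel X R \<longleftrightarrow>
     (\<forall>\<alpha>\<in>R. range \<alpha> \<subseteq> X) \<and>
     (\<forall>x\<in>X. (\<lambda>_. x) \<in> R) \<and>
     (\<forall>\<alpha>\<in>R. \<forall>f\<in>borel_measurable borel. \<alpha> \<circ> f \<in> R) \<and>
     (\<forall>(U :: nat \<Rightarrow> real set) \<alpha> \<beta>.
        disjoint_family U \<longrightarrow> (\<Union>i. U i) = UNIV \<longrightarrow> (\<forall>i. U i \<in> sets borel) \<longrightarrow>
        (\<forall>i. \<alpha> i \<in> R) \<longrightarrow> (\<forall>i. \<forall>r\<in>U i. \<beta> r = \<alpha> i r) \<longrightarrow> \<beta> \<in> R)"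

typedef 'a quasi_borel = "{(X :: 'a set, R). is_quasi_borel X R}"
  morphisms rep_quasi_borel Abs_quasi_borel
  by (rule exI[of _ "({}, {})"]) (auto simp: is_quasi_borel_def)

definition qbs_space :: "'a quasi_borel \<Rightarrow> 'a set" where
  "qbs_space X = fst (rep_quasi_borel X)"

definition qbs_random :: "'a quasi_borel \<Rightarrow> (real \<Rightarrow> 'a) set" where
  "qbs_random X = snd (rep_quasi_borel X)"

lemma is_quasi_borel_rep: "is_quasi_borel (qbs_space X) (qbs_random X)"
  using rep_quasi_borel[of X] by (auto simp: qbs_space_def qbs_random_def)

lemma qbs_space_Abs [simp]: "is_quasi_borel X R \<Longrightarrow> qbs_space (Abs_quasi_borel (X, R)) = X"
  by (simp add: qbs_space_def Abs_quasi_borel_inverse)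

lemma qbs_random_Abs [simp]: "is_quasi_borel X R \<Longrightarrow> qbs_random (Abs_quasi_borel (X, R)) = R"
  by (simp add: qbs_random_def Abs_quasi_borel_inverse)

definition qbs_morphisms :: "'a quasi_borel \<Rightarrow> 'b quasi_borel \<Rightarrow> ('a \<Rightarrow> 'b) set" where
  "qbs_morphisms X Y =
     {f. f ` qbs_space X \<subseteq> qbs_space Y \<and> (\<forall>\<alpha>\<in>qbs_random X. f \<circ> \<alpha> \<in> qbs_random Y)}"

definition qbs_of :: "'a measure \<Rightarrow> 'a quasi_borel" where
  "qbs_of \<Omega> = Abs_quasi_borel (space \<Omega>, borel \<rightarrow>\<^sub>M \<Omega>)"

lemma is_quasi_borel_measurable: "is_quasi_borel (space \<Omega>) (borel \<rightarrow>\<^sub>M \<Omega>)"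
proof -
  have glue: "\<beta> \<in> borel \<rightarrow>\<^sub>M \<Omega>"
    if U: "(\<Union>i. U i) = UNIV" "\<And>i. U i \<in> sets borel"
      and \<alpha>: "\<And>i. \<alpha> i \<in> borel \<rightarrow>\<^sub>M \<Omega>" and eq: "\<And>i r. r \<in> U i \<Longrightarrow> \<beta> r = \<alpha> i r"
    for U :: "nat \<Rightarrow> real set" and \<alpha> \<beta>
  proof (rule measurable_piecewise_restrict[where C = "range U"])
    show "\<beta> \<in> restrict_space borel V \<rightarrow>\<^sub>M \<Omega>" if V: "V \<in> range U" for V
    proof -
      from V obtain i where i: "V = U i" by auto
      have "\<alpha> i \<in> restrict_space borel V \<rightarrow>\<^sub>M \<Omega>"
        using \<alpha> by (rule measurable_restrict_space1)
      then show ?thesis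
        by (rule measurable_cong[THEN iffD1, rotated])
           (auto simp: i eq space_restrict_space)
    qed
  qed (use U in auto)
  show ?thesis
    unfolding is_quasi_borel_def
  proof (intro conjI ballI allI impI)
    show "range \<alpha> \<subseteq> space \<Omega>" if "\<alpha> \<in> borel \<rightarrow>\<^sub>M \<Omega>" for \<alpha> :: "real \<Rightarrow> 'a"
      using measurable_space[OF that] by auto
    show "\<beta> \<in> borel \<rightarrow>\<^sub>M \<Omega>"
      if "(\<Union>i. U i) = UNIV" "\<forall>i. U i \<in> sets borel" "\<forall>i. \<alpha> i \<in> borel \<rightarrow>\<^sub>M \<Omega>"
        "\<forall>i. \<forall>r\<in>U i. \<beta> r = \<alpha> i r" for U :: "nat \<Rightarrow> real set" and \<alpha> \<beta>
      by (rule glue[of U \<alpha>]) (use that in blast)+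
  qed (simp_all add: measurable_comp)
qed

lemma qbs_space_qbs_of [simp]: "qbs_space (qbs_of \<Omega>) = space \<Omega>"
  and qbs_random_qbs_of [simp]: "qbs_random (qbs_of \<Omega>) = borel \<rightarrow>\<^sub>M \<Omega>"
  by (simp_all add: qbs_of_def is_quasi_borel_measurable)

definition qbs_sets :: "'a quasi_borel \<Rightarrow> 'a set set" where
  "qbs_sets X = {U. U \<subseteq> qbs_space X \<and> (\<forall>\<alpha>\<in>qbs_random X. \<alpha> -` U \<in> sets borel)}"

definition qbs_algebra :: "'a quasi_borel \<Rightarrow> 'a measure" where
  "qbs_algebra X = sigma (qbs_space X) (qbs_sets X)"

lemma sigma_algebra_qbs_sets: "sigma_algebra (qbs_space X) (qbs_sets X)"
  unfolding sigma_algebra_iff2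
proof (intro conjI ballI allI impI)
  show "qbs_space X - U \<in> qbs_sets X" if "U \<in> qbs_sets X" for U
  proof -
    have "range \<alpha> \<subseteq> qbs_space X" if "\<alpha> \<in> qbs_random X" for \<alpha>
      using is_quasi_borel_rep[of X, unfolded is_quasi_borel_def, THEN conjunct1] that by (rule bspec)
    then have "\<alpha> -` (qbs_space X - U) = - (\<alpha> -` U)" if "\<alpha> \<in> qbs_random X" for \<alpha>
      using that by blast
    then show ?thesis using that by (auto simp: qbs_sets_def)
  qed
  show "(\<Union>i. U i) \<in> qbs_sets X" if "range U \<subseteq> qbs_sets X" for U :: "nat \<Rightarrow> 'a set"
  proof -
    have U: "U i \<in> qbs_sets X" for i using that by auto
    have "\<alpha> -` (\<Union>i. U i) \<in> sets borel" if "\<alpha> \<in> qbs_random X" for \<alpha>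
      unfolding vimage_UN using U that by (intro sets.countable_UN) (auto simp: qbs_sets_def)
    moreover have "(\<Union>i. U i) \<subseteq> qbs_space X" using U by (auto simp: qbs_sets_def)
    ultimately show ?thesis by (simp add: qbs_sets_def)
  qed
qed (auto simp: qbs_sets_def)

lemma space_qbs_algebra [simp]: "space (qbs_algebra X) = qbs_space X"
  and sets_qbs_algebra [simp]: "sets (qbs_algebra X) = qbs_sets X"
  using sigma_algebra_qbs_sets[of X]
  by (auto simp: qbs_algebra_def qbs_sets_def sigma_algebra.sets_measure_of_eq
      intro!: space_measure_of)

section \<open>Standard Borel spaces and s-finite measures\<close>

text \<open>Only the measurable space underlying \<open>M\<close> matters: its \<open>\<sigma>\<close>-algebra is generated by some
  Polish topology on its carrier.\<close>

definition standard_borel :: "'a measure \<Rightarrow> bool" where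
  "standard_borel M \<longleftrightarrow>
     (\<exists>T. completely_metrizable_space T \<and> second_countable T \<and> topspace T = space M \<and>
          sets M = sigma_sets (topspace T) {U. openin T U})"

definition s_finite_measure :: "'a measure \<Rightarrow> bool" where
  "s_finite_measure M \<longleftrightarrow>
     (\<exists>N :: nat \<Rightarrow> 'a measure. (\<forall>i. sets (N i) = sets M \<and> finite_measure (N i)) \<and>
        (\<forall>A\<in>sets M. emeasure M A = (\<Sum>i. emeasure (N i) A)))"

section \<open>Measures on a quasi-Borel space\<close>

text \<open>A triple \<open>\<langle>\<Omega>, \<mu>, \<alpha>\<rangle>\<close> is the pair of \<open>\<mu>\<close>, whose underlying measurable space is \<open>\<Omega>\<close>, and \<open>\<alpha>\<close>.
  Its class is represented by the pushforward of \<open>\<mu>\<close> along \<open>\<alpha>\<close>. The points of \<open>\<Omega>\<close> are taken from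
  the type of real numbers, but carrier and \<open>\<sigma>\<close>-algebra are arbitrary, not necessarily those of the
  real line. This is no restriction: by \<open>distr_in_qbs_measures\<close> below, triples over standard Borel
  spaces of any type yield the same measures.\<close>

definition qbs_measures :: "'a quasi_borel \<Rightarrow> 'a measure set" where
  "qbs_measures X =
     {distr \<mu> (qbs_algebra X) \<alpha> | (\<mu> :: real measure) \<alpha>.
        standard_borel \<mu> \<and> s_finite_measure \<mu> \<and> \<alpha> \<in> qbs_morphisms (qbs_of \<mu>) X}"

lemma sets_qbs_measures: "m \<in> qbs_measures X \<Longrightarrow> sets m = qbs_sets X"
  and space_qbs_measures: "m \<in> qbs_measures X \<Longrightarrow> space m = qbs_space X"
  by (auto simp: qbs_measures_def)

lemma standard_borel_inj_real:
  fixes M :: "'b measure"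
  assumes "standard_borel M"
  obtains h :: "'b \<Rightarrow> real" where "inj_on h (space M)"
proof -
  obtain T where T: "completely_metrizable_space T" "second_countable T" "topspace T = space M"
    using assms by (auto simp: standard_borel_def)
  obtain B where B: "countable B" "\<And>V. V \<in> B \<Longrightarrow> openin T V"
      "\<And>U x. openin T U \<Longrightarrow> x \<in> U \<Longrightarrow> \<exists>V\<in>B. x \<in> V \<and> V \<subseteq> U"
    using T(2) unfolding second_countable_def by metis
  have "Hausdorff_space T"
    using T(1) completely_metrizable_imp_metrizable_space metrizable_imp_Hausdorff_space by blast
  obtain f :: "nat set \<Rightarrow> real" where f: "inj f"
    using nat_sets_eqpoll_reals by (auto simp: eqpoll_def bij_betw_def)
  define g where "g x = to_nat_on B ` {V\<in>B. x \<in> V}" for x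
  have "x = y" if xy: "x \<in> space M" "y \<in> space M" "g x = g y" for x y
  proof (rule ccontr)
    assume "x \<noteq> y"
    then obtain U where U: "openin T U" "x \<in> U" "y \<notin> U"
      using \<open>Hausdorff_space T\<close> xy(1,2) T(3) unfolding Hausdorff_space_def disjnt_iff by metis
    then obtain V where V: "V \<in> B" "x \<in> V" "V \<subseteq> U" using B(3) by blast
    then have "to_nat_on B V \<in> g y" using xy(3) by (auto simp: g_def)
    then obtain W where "W \<in> B" "y \<in> W" "to_nat_on B W = to_nat_on B V" by (auto simp: g_def)
    with V B(1) have "W = V" by simp
    with \<open>y \<in> W\<close> V U show False by auto
  qed
  then have "inj_on (f \<circ> g) (space M)" using f by (auto simp: inj_on_def)
  with that show ?thesis by blast
qed

lemma distr_in_qbs_measures: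
  fixes M :: "'b measure"
  assumes M: "standard_borel M" "s_finite_measure M" and \<alpha>: "\<alpha> \<in> qbs_morphisms (qbs_of M) X"
  shows "distr M (qbs_algebra X) \<alpha> \<in> qbs_measures X"
proof -
  obtain h :: "'b \<Rightarrow> real" where h: "inj_on h (space M)"
    using standard_borel_inj_real[OF M(1)] .
  define k where "k = inv_into (space M) h"
  have kh: "k (h x) = x" if "x \<in> space M" for x using h that by (simp add: k_def)
  define S where "S = (`) h ` sets M"
  have S_Pow: "S \<subseteq> Pow (h ` space M)" using sets.sets_into_space by (fastforce simp: S_def)
  have vim: "h -` (h ` A) \<inter> space M = A" if "A \<in> sets M" for A
    using h that sets.sets_into_space[OF that] by (auto simp: inj_on_def)
  have S_iff: "A \<in> S \<longleftrightarrow> A \<subseteq> h ` space M \<and> h -` A \<inter> space M \<in> sets M" for A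
  proof
    assume "A \<in> S" then show "A \<subseteq> h ` space M \<and> h -` A \<inter> space M \<in> sets M"
      using vim S_Pow by (auto simp: S_def)
  next
    assume *: "A \<subseteq> h ` space M \<and> h -` A \<inter> space M \<in> sets M"
    then have "A = h ` (h -` A \<inter> space M)" by auto
    with * show "A \<in> S" by (auto simp: S_def)
  qed
  have S_alg: "sigma_algebra (h ` space M) S"
    unfolding sigma_algebra_iff2
  proof (intro conjI ballI allI impI)
    show "h ` space M - A \<in> S" if "A \<in> S" for A
    proof -
      have "h -` (h ` space M - A) \<inter> space M = space M - (h -` A \<inter> space M)" by auto
      with that show ?thesis unfolding S_iff by auto
    qed
    show "(\<Union>i. A i) \<in> S" if "range A \<subseteq> S" for A :: "nat \<Rightarrow> real set"
    proof -
      have A: "A i \<in> S" for i using that by auto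
      then have "(\<Union>i. h -` A i \<inter> space M) \<in> sets M" unfolding S_iff by blast
      moreover have "h -` (\<Union>i. A i) \<inter> space M = (\<Union>i. h -` A i \<inter> space M)" by auto
      ultimately have "h -` (\<Union>i. A i) \<inter> space M \<in> sets M" by metis
      moreover have "(\<Union>i. A i) \<subseteq> h ` space M" using A S_Pow by blast
      ultimately show ?thesis unfolding S_iff by blast
    qed
  qed (use S_Pow in \<open>auto simp: S_iff\<close>)
  define \<Omega> where "\<Omega> = sigma (h ` space M) S"
  have sp: "space \<Omega> = h ` space M" and st: "sets \<Omega> = S"
    using S_Pow sigma_algebra.sigma_sets_eq[OF S_alg]
    by (simp_all add: \<Omega>_def space_measure_of sets_measure_of)
  define N where "N m = distr m \<Omega> h" for m :: "'b measure"
  have N: "space (N m) = h ` space M" "sets (N m) = S" for m by (simp_all add: N_def sp st)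
  have hm: "h \<in> m \<rightarrow>\<^sub>M \<Omega>" if "sets m = sets M" for m
    using that sets_eq_imp_space_eq[OF that] by (auto simp: measurable_def sp st S_iff)
  have em: "emeasure (N m) A = emeasure m (h -` A \<inter> space M)"
    if "sets m = sets M" "A \<in> S" for m A
    using emeasure_distr[OF hm[OF that(1)], of A] that sets_eq_imp_space_eq[OF that(1)]
    by (simp add: N_def st)
  have "s_finite_measure (N M)"
  proof -
    obtain F :: "nat \<Rightarrow> 'b measure" where
      F: "\<And>i. sets (F i) = sets M" "\<And>i. finite_measure (F i)"
        "\<And>A. A \<in> sets M \<Longrightarrow> emeasure M A = (\<Sum>i. emeasure (F i) A)"
      using M(2) unfolding s_finite_measure_def by blast
    have "finite_measure (N (F i))" for i
      unfolding N_def by (intro finite_measure.finite_measure_distr F hm)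
    then show ?thesis
      unfolding s_finite_measure_def
      by (intro exI[of _ "\<lambda>i. N (F i)"]) (auto simp: N em F S_iff)
  qed
  moreover have "standard_borel (N M)"
  proof -
    obtain T where T: "completely_metrizable_space T" "second_countable T" "topspace T = space M"
        "sets M = sigma_sets (topspace T) {U. openin T U}"
      using M(1) by (auto simp: standard_borel_def)
    define T' where "T' = pullback_topology (h ` space M) k T"
    have k: "k \<in> h ` space M \<rightarrow> space M" using kh by auto
    have hk: "h (k y) = y" if "y \<in> h ` space M" for y using that kh by auto
    have op: "openin T' V \<longleftrightarrow> (\<exists>U. openin T U \<and> V = k -` U \<inter> h ` space M)" for V
      unfolding T'_def openin_pullback_topology ..
    have top: "topspace T' = h ` space M"
      using k T(3) by (auto simp: T'_def topspace_pullback_topology)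
    have im: "k -` U \<inter> h ` space M = h ` U" if "U \<subseteq> space M" for U
      using that kh by force
    have op': "{V. openin T' V} = (`) h ` {U. openin T U}"
      unfolding op using im openin_subset[of T] T(3) by (auto simp: image_iff) metis+
    have "homeomorphic_maps T T' h k"
      unfolding homeomorphic_maps_def continuous_map_def top T(3)
    proof (intro conjI allI impI ballI)
      show "openin T {x \<in> space M. h x \<in> U}" if U: "openin T' U" for U
      proof -
        obtain V where V: "openin T V" "U = k -` V \<inter> h ` space M"
          using U unfolding op by blast
        then have "{x \<in> space M. h x \<in> U} = V"
          using openin_subset[OF V(1)] T(3) kh by (auto dest: inj_onD[OF h])
        with V show ?thesis by simp
      qed
      show "openin T' {x \<in> h ` space M. k x \<in> U}" if "openin T U" for U
        unfolding op using that by (intro exI[of _ U]) auto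
    qed (use k kh hk in auto)
    then have hom: "T homeomorphic_space T'" by (auto simp: homeomorphic_space_def)
    have "S = sigma_sets (h ` space M) {V. openin T' V}"
    proof
      show "S \<subseteq> sigma_sets (h ` space M) {V. openin T' V}"
      proof
        fix A assume "A \<in> S"
        then obtain A' where A': "A' \<in> sets M" "A = h ` A'" by (auto simp: S_def)
        have "h ` A' \<in> sigma_sets (h ` space M) {V. openin T' V}"
          using A'(1) unfolding T(4)
        proof induction
          case (Basic a) then show ?case unfolding op' by blast
        next
          case Empty then show ?case by (simp add: sigma_sets.Empty)
        next
          case (Compl a)
          then have "a \<in> sets M" by (simp add: T(4))
          then have "h ` (topspace T - a) = h ` space M - h ` a"
            unfolding T(3) using sets.sets_into_space
            by (intro inj_on_image_set_diff[OF h]) auto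
          with Compl.IH show ?case by (simp add: sigma_sets.Compl)
        next
          case (Union a) then show ?case by (simp add: image_UN sigma_sets.Union)
        qed
        with A' show "A \<in> sigma_sets (h ` space M) {V. openin T' V}" by simp
      qed
      show "sigma_sets (h ` space M) {V. openin T' V} \<subseteq> S"
        by (rule sigma_algebra.sigma_sets_subset[OF S_alg])
           (auto simp: op' S_def T(4))
    qed
    then show ?thesis
      unfolding standard_borel_def
      using T homeomorphic_completely_metrizable_space[OF hom]
        homeomorphic_space_second_countability[OF hom]
      by (intro exI[of _ T']) (auto simp: N top)
  qed
  moreover have "\<alpha> \<circ> k \<in> qbs_morphisms (qbs_of (N M)) X"
  proof -
    have "k \<circ> \<beta> \<in> borel \<rightarrow>\<^sub>M M" if \<beta>: "\<beta> \<in> borel \<rightarrow>\<^sub>M N M" for \<beta> :: "real \<Rightarrow> real"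
    proof (rule measurable_comp[OF \<beta>])
      have "k -` A \<inter> h ` space M = h ` A" if "A \<in> sets M" for A
        using sets.sets_into_space[OF that] kh by force
      then show "k \<in> N M \<rightarrow>\<^sub>M M" using kh by (auto simp: measurable_def N S_def)
    qed
    then show ?thesis
      using \<alpha> kh by (auto simp: qbs_morphisms_def N comp_assoc)
  qed
  moreover have "distr M (qbs_algebra X) \<alpha> = distr (N M) (qbs_algebra X) (\<alpha> \<circ> k)"
  proof -
    have "emeasure M (\<alpha> -` A \<inter> space M) = emeasure (N M) ((\<alpha> \<circ> k) -` A \<inter> space (N M))" for A
    proof -
      let ?A = "(\<alpha> \<circ> k) -` A \<inter> h ` space M"
      have eq: "h -` ?A \<inter> space M = \<alpha> -` A \<inter> space M"
        using kh by (auto dest: inj_onD[OF h])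
      show ?thesis
      proof (cases "?A \<in> S")
        case True then show ?thesis using em[of M ?A] eq by (simp add: N)
      next
        case False
        then have "\<alpha> -` A \<inter> space M \<notin> sets M" unfolding S_iff eq by auto
        then show ?thesis using False by (simp add: N emeasure_notin_sets)
      qed
    qed
    then show ?thesis unfolding distr_def by simp
  qed
  ultimately show ?thesis unfolding qbs_measures_def by blast
qed

section \<open>Relations between measures\<close>

text \<open>All notions below are meant for measures \<open>m\<close> and \<open>n\<close> with \<open>sets m = sets n\<close>, which holds
  for the elements of \<open>qbs_measures X\<close>. The relation \<open>m \<lless> n\<close> is
  \<open>absolutely_continuous n m\<close>, with the arguments in this order.\<close>

definition mutually_singular :: "'a measure \<Rightarrow> 'a measure \<Rightarrow> bool" where
  "mutually_singular m n \<longleftrightarrow>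
     (\<exists>A\<in>sets m. emeasure m (space m - A) = 0 \<and> emeasure n A = 0)"

definition zero_inf_set :: "'a measure \<Rightarrow> 'a set \<Rightarrow> bool" where
  "zero_inf_set m U \<longleftrightarrow>
     U \<in> sets m \<and> (\<forall>V\<in>sets m. V \<subseteq> U \<longrightarrow> emeasure m V \<in> {0, \<infinity>})"

definition inf_absolutely_continuous :: "'a measure \<Rightarrow> 'a measure \<Rightarrow> bool" where
  "inf_absolutely_continuous m n \<longleftrightarrow>
     absolutely_continuous n m \<and> (\<forall>U. zero_inf_set n U \<longrightarrow> zero_inf_set m U)"

definition inf_singular :: "'a measure \<Rightarrow> 'a measure \<Rightarrow> bool" where
  "inf_singular m n \<longleftrightarrow>
     absolutely_continuous n m \<and>
     (\<forall>U. zero_inf_set m U \<longrightarrow> emeasure m U = 0) \<and>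
     (\<exists>A\<in>sets m. emeasure m (space m - A) = 0 \<and> zero_inf_set n A)"

end

theory Submission
  imports Defs
begin

text \<open>A nonempty standard Borel space is a measurable retract of the real line, so a morphism into \<open>X\<close>
  is measurable for \<open>\<Sigma>\<^sub>X\<close>, and elements of \<open>TX\<close> are s-finite measures that can be restricted to sets
  in \<open>\<Sigma>\<^sub>X\<close>. Both \<open>\<mu>\<close> and \<open>\<nu>\<close> have densities \<open>f\<close> and \<open>g\<close>, with values in \<open>[0, \<infinity>]\<close>, with respect to a
  common finite measure. The components are the restrictions of \<open>\<mu>\<close> to \<open>{g = 0}\<close> (singular), to
  \<open>{g = \<infinity>, 0 < f < \<infinity>}\<close> (\<open>\<infinity>\<close>-singular), and to the rest.

  Uniqueness needs no densities. Given two decompositions, let \<open>I'\<close> and \<open>I\<close> carry their \<open>\<infinity>\<close>-singular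
  components. Once the singular components are known to agree, \<open>\<mu>\<close> coincides on \<open>I' - I\<close> with the
  absolutely continuous component of one and with the \<open>\<infinity>\<close>-singular component of the other; as
  \<open>I' - I\<close> is a \<open>\<nu>\<close>-\<open>0\<close>-\<open>\<infinity>\<close>-set, it is then a \<open>0\<close>-\<open>\<infinity>\<close>-set of the latter, hence \<open>\<mu>\<close>-null.\<close>

section \<open>Standard Borel spaces as retracts of the real line\<close>

text \<open>Binary digits would not do: base 3 makes the tail after any digit strictly smaller than one
  unit of that digit.\<close>

lemma floor_ternary_series:
  fixes b :: "nat \<Rightarrow> bool" and n :: nat
  shows "\<lfloor>3 ^ n * (\<Sum>m. of_bool (b m) / 3 ^ m :: real)\<rfloor> mod 3 = of_bool (b n)"
proof -
  define f :: "nat \<Rightarrow> real" where "f m = of_bool (b m) / 3 ^ m" for m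
  have geo: "summable (\<lambda>m. (1/3 :: real) ^ m)" by (simp add: summable_geometric)
  have f: "summable f"
    by (rule summable_comparison_test[OF _ geo])
       (auto intro!: exI[of _ 0] simp: f_def power_divide)
  \<comment> \<open>Scaled by \<open>3 ^ n\<close>, the digits beyond \<open>n\<close> contribute at
    most 1/2, the value of a geometric series, so the floor does not see them.\<close>
  define tail where "tail = (\<Sum>m. f (m + Suc n))"
  have sums: "summable (\<lambda>m. f (m + Suc n))" using f by (subst summable_iff_shift)
  have "0 \<le> tail" unfolding tail_def by (intro suminf_nonneg sums) (simp add: f_def)
  have "tail \<le> (\<Sum>m. (1/3) ^ Suc n * (1/3 :: real) ^ m)"
    unfolding tail_def
    by (intro suminf_le sums summable_mult geo)
       (simp add: f_def power_divide power_add field_simps)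
  also have "\<dots> = (1/3) ^ Suc n * (3/2)"
    by (subst suminf_mult[OF geo]) (simp add: suminf_geometric)
  finally have "3 ^ n * tail \<le> 3 ^ n * ((1/3) ^ Suc n * (3/2))" by (intro mult_left_mono) auto
  also have "\<dots> = 1/2" by (simp add: power_divide)
  finally have tail_less: "3 ^ n * tail < 1" by simp
  \<comment> \<open>The digits before \<open>n\<close> contribute the integer \<open>3 * K\<close>,
    which vanishes modulo 3. One factor 3 is split off from every power to show this.\<close>
  define K :: int where "K = (\<Sum>m<n. of_bool (b m) * 3 ^ (n - m - 1))"
  have "3 ^ n * f m = of_int (3 * (of_bool (b m) * 3 ^ (n - m - 1)))" if "m < n" for m
  proof -
    have "(3::real) ^ n = 3 ^ m * (3 * 3 ^ (n - m - 1))"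
      using that by (simp flip: power_Suc power_add)
    then show ?thesis by (simp add: f_def)
  qed
  then have "3 ^ n * (\<Sum>m<n. f m) = of_int (3 * K)"
    by (simp add: sum_distrib_left K_def del: of_int_mult sum_of_bool_mult_eq sum_mult_of_bool_eq)
  moreover have "(\<Sum>m. f m) = tail + (\<Sum>m<n. f m) + f n"
    using suminf_split_initial_segment[OF f, of "Suc n"] by (simp add: tail_def)
  ultimately have "3 ^ n * (\<Sum>m. f m) = of_int (3 * K + of_bool (b n)) + 3 ^ n * tail"
    by (simp add: algebra_simps f_def)
  then have "\<lfloor>3 ^ n * (\<Sum>m. f m)\<rfloor> = 3 * K + of_bool (b n)"
    using \<open>0 \<le> tail\<close> tail_less by (intro floor_unique) auto
  then show ?thesis by (simp add: f_def of_bool_def)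
qed

text \<open>A point \<open>x\<close> is coded by the real number whose ternary digits record, for all \<open>k\<close> and \<open>i\<close>,
  whether \<open>d x (D i) < 2\<^sup>-\<^sup>k\<close>, for a dense sequence \<open>D\<close>; it is recovered as the limit of the first
  members of \<open>D\<close> within \<open>2\<^sup>-\<^sup>k\<close> of it.\<close>

lemma standard_borel_real_retract:
  fixes M :: "'a measure"
  assumes "standard_borel M" "space M \<noteq> {}"
  obtains s :: "'a \<Rightarrow> real" and b :: "real \<Rightarrow> 'a"
  where "s \<in> borel_measurable M" "b \<in> borel \<rightarrow>\<^sub>M M" "\<forall>x\<in>space M. b (s x) = x"
proof -
  obtain T where T: "completely_metrizable_space T" "second_countable T" "topspace T = space M"
      "sets M = sigma_sets (topspace T) {U. openin T U}"
    using assms(1) by (auto simp: standard_borel_def)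
  obtain S d where S: "Metric_space S d" "Metric_space.mcomplete S d" "T = Metric_space.mtopology S d"
    using T(1) unfolding completely_metrizable_space_def by blast
  interpret Metric_space S d by fact
  have SM: "space M = S" using T(3) S(3) by simp
  obtain C where C: "countable C" "C \<subseteq> S" "T closure_of C = S"
    using second_countable_imp_separable_space[OF T(2)] T(3) SM
    unfolding separable_space_def by auto
  have "C \<noteq> {}" using C(3) assms(2) SM by auto
  define D where "D = from_nat_into C"
  have rD: "range D = C" unfolding D_def using C \<open>C \<noteq> {}\<close> by (simp add: range_from_nat_into)
  then have DS: "D i \<in> S" for i using C(2) by auto
  have dense: "\<exists>i. d x (D i) < e" if x: "x \<in> S" and "e > 0" for x e
  proof -
    have "\<exists>y\<in>C. y \<in> mball x e"
      using C(3) x \<open>e > 0\<close> unfolding S(3) metric_closure_of by blast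
    then show ?thesis using rD by (auto simp: in_mball)
  qed
  let ?h = "\<lambda>k. (1/2 :: real) ^ k"
  define near where "near n x = (case prod_decode n of (k, i) \<Rightarrow> d x (D i) < ?h k)" for n x
  define s :: "'a \<Rightarrow> real" where "s x = (\<Sum>n. of_bool (near n x) / 3 ^ n)" for x
  have near_meas: "{x \<in> space M. near n x} \<in> sets M" for n
  proof -
    obtain k i where ki: "prod_decode n = (k, i)" by fastforce
    have "{x \<in> space M. near n x} = mball (D i) (?h k)"
      using DS by (auto simp: near_def ki SM in_mball commute)
    moreover have "mball (D i) (?h k) \<in> sets M" unfolding T(4) S(3) by (intro sigma_sets.Basic) simp
    ultimately show ?thesis by simp
  qed
  have s: "s \<in> borel_measurable M"
    unfolding s_def
  proof (intro borel_measurable_suminf)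
    fix n
    have [measurable]: "Measurable.pred M (near n)" using near_meas by (simp add: pred_def)
    show "(\<lambda>x. of_bool (near n x) / 3 ^ n :: real) \<in> borel_measurable M"
      unfolding of_bool_def by measurable
  qed
  \<comment> \<open>Reads the digit for the pair \<open>(k, i)\<close> from an arbitrary real. The
    condition is Borel in \<open>r\<close>, and on codes of points it becomes the metric condition
    again.\<close>
  define P where "P k i r \<longleftrightarrow> \<lfloor>3 ^ prod_encode (k, i) * r\<rfloor> mod 3 = 1" for k i and r :: real
  have P_meas [measurable]: "Measurable.pred borel (P k i)" for k i
    unfolding P_def by measurable
  have P_s: "P k i (s x) \<longleftrightarrow> d x (D i) < ?h k" for k i x
    unfolding P_def s_def floor_ternary_series by (auto simp: near_def)
  \<comment> \<open>On a code some index satisfies \<open>P k\<close>, because \<open>D\<close> is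
    dense. Where none does, \<open>LEAST\<close> yields a fixed unspecified index, which keeps
    \<open>c k\<close> measurable.\<close>
  define c where "c k r = (LEAST i. P k i r)" for k r
  have [measurable]: "c k \<in> borel \<rightarrow>\<^sub>M count_space UNIV" for k
    unfolding c_def by measurable
  have c_s: "d x (D (c k (s x))) < ?h k" if x: "x \<in> S" for k x
  proof -
    obtain i where "d x (D i) < ?h k" using dense[OF x, of "?h k"] by auto
    then show ?thesis unfolding c_def P_s by (rule LeastI)
  qed
  \<comment> \<open>A Borel condition that holds for every code, by the triangle inequality, and
    forces the points \<open>D (c k r)\<close> to form a Cauchy sequence with a known rate.\<close>
  define good where "good r \<longleftrightarrow> (\<forall>k l. d (D (c k r)) (D (c l r)) < ?h k + ?h l)" for r
  have good_meas [measurable]: "Measurable.pred borel good"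
    unfolding good_def by measurable
  have good_s: "good (s x)" if x: "x \<in> S" for x
    unfolding good_def
  proof (intro allI)
    fix k l
    show "d (D (c k (s x))) (D (c l (s x))) < ?h k + ?h l"
      using triangle''[OF DS x DS, of "c k (s x)" "c l (s x)"] c_s[OF x, of k] c_s[OF x, of l]
        commute[of x] by (smt (verit))
  qed
  have h_small: "\<exists>N. \<forall>n\<ge>N. ?h n < e" if e: "e > 0" for e
  proof -
    obtain N where N: "?h N < e" using real_arch_pow_inv[OF e, of "1/2 :: real"] by auto
    have "?h n \<le> ?h N" if "n \<ge> N" for n using that by (intro power_decreasing) auto
    then show ?thesis using N by (meson order_le_less_trans)
  qed
  have lim_ex: "\<exists>L\<in>S. \<forall>k. d L (D (c k r)) \<le> ?h k" if r: "good r" for r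
  proof -
    have "MCauchy (\<lambda>k. D (c k r))"
      unfolding MCauchy_def
    proof (intro conjI allI impI)
      fix e :: real assume "e > 0"
      then obtain N where N: "\<forall>n\<ge>N. ?h n < e/2" using h_small[of "e/2"] by auto
      show "\<exists>N. \<forall>n n'. N \<le> n \<longrightarrow> N \<le> n' \<longrightarrow> d (D (c n r)) (D (c n' r)) < e"
      proof (intro exI[of _ N] allI impI)
        fix n n' assume n: "N \<le> n" "N \<le> n'"
        then have "?h n < e/2" "?h n' < e/2" using N by auto
        then show "d (D (c n r)) (D (c n' r)) < e"
          using r unfolding good_def by (smt (verit) field_sum_of_halves)
      qed
    qed (use DS in auto)
    then obtain L where L: "limitin mtopology (\<lambda>k. D (c k r)) L sequentially"
      using S(2) unfolding mcomplete_def by blast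
    then have LS: "L \<in> S" and ev: "\<And>e. e > 0 \<Longrightarrow> \<forall>\<^sub>F n in sequentially. d (D (c n r)) L < e"
      unfolding limitin_metric by (auto elim: eventually_mono)
    have "d L (D (c k r)) \<le> ?h k" for k
    proof (rule field_le_epsilon)
      fix e :: real assume "e > 0"
      obtain N1 where N1: "\<forall>n\<ge>N1. d (D (c n r)) L < e/2"
        using ev[of "e/2"] \<open>e > 0\<close> by (auto simp: eventually_sequentially)
      obtain N2 where N2: "\<forall>n\<ge>N2. ?h n < e/2" using h_small[of "e/2"] \<open>e > 0\<close> by auto
      define n where "n = max N1 N2"
      have "d (D (c n r)) L < e/2" "?h n < e/2" using N1 N2 by (auto simp: n_def)
      moreover have "d (D (c n r)) (D (c k r)) < ?h n + ?h k" using r by (simp add: good_def)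
      moreover have "d L (D (c k r)) \<le> d L (D (c n r)) + d (D (c n r)) (D (c k r))"
        by (intro triangle LS DS)
      ultimately show "d L (D (c k r)) \<le> ?h k + e" by (simp add: commute)
    qed
    with LS show ?thesis by blast
  qed
  then obtain L where L: "\<And>r. good r \<Longrightarrow> L r \<in> S" "\<And>r k. good r \<Longrightarrow> d (L r) (D (c k r)) \<le> ?h k"
    by metis
  \<comment> \<open>The default \<open>D 0\<close> is just some point of the space, so that
    \<open>b\<close> is defined on the whole line.\<close>
  define b where "b r = (if good r then L r else D 0)" for r
  have bS: "b r \<in> S" for r using L(1) DS by (simp add: b_def)
  have close: "x = y" if xy: "x \<in> S" "y \<in> S" "\<And>k. d x (D (j k)) \<le> ?h k" "\<And>k. d y (D (j k)) \<le> ?h k"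
    for x y j
  proof -
    have "d x y \<le> 0 + e" if "e > 0" for e
    proof -
      obtain n where "?h n < e/2" using h_small[of "e/2"] \<open>e > 0\<close> by auto
      then show ?thesis
        using triangle''[OF xy(1) DS xy(2), of "j n"] triangle[OF xy(1) DS xy(2), of "j n"]
          xy(3)[of n] xy(4)[of n] commute[of y "D (j n)"] by linarith
    qed
    then have "d x y \<le> 0" by (rule field_le_epsilon)
    then have "d x y = 0" using nonneg[of x y] by linarith
    then show ?thesis using zero[OF xy(1,2)] by simp
  qed
  have bs: "b (s x) = x" if "x \<in> space M" for x
  proof -
    have x: "x \<in> S" using that SM by simp
    note g = good_s[OF x]
    show ?thesis
      using close[of "L (s x)" x "\<lambda>k. c k (s x)"] L[OF g] x c_s[OF x] g
      by (auto simp: b_def intro: less_imp_le)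
  qed
  \<comment> \<open>Closed balls are chosen because their inequality survives the passage to the
    limit. Membership of the limit then amounts to countably many conditions on the indices
    \<open>c k r\<close>, each Borel in \<open>r\<close>.\<close>
  have ball: "b r \<in> mcball (D i) q \<longleftrightarrow> (if good r then \<forall>k. d (D (c k r)) (D i) \<le> q + ?h k else d (D i) (D 0) \<le> q)"
    for r i q
  proof (cases "good r")
    case True
    have "d (D i) (L r) \<le> q \<longleftrightarrow> (\<forall>k. d (D (c k r)) (D i) \<le> q + ?h k)"
    proof
      assume "d (D i) (L r) \<le> q"
      then show "\<forall>k. d (D (c k r)) (D i) \<le> q + ?h k"
        using triangle[OF DS L(1)[OF True] DS] L(2)[OF True] commute by (smt (verit))
    next
      assume *: "\<forall>k. d (D (c k r)) (D i) \<le> q + ?h k"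
      show "d (D i) (L r) \<le> q"
      proof (rule field_le_epsilon)
        fix e :: real assume "e > 0"
        then obtain n where n: "?h n < e/2" using h_small[of "e/2"] by auto
        have "d (D i) (L r) \<le> d (D i) (D (c n r)) + d (D (c n r)) (L r)"
          by (intro triangle DS L True)
        also have "\<dots> \<le> (q + ?h n) + ?h n"
          using * L(2)[OF True, of n] by (intro add_mono) (simp_all add: commute)
        finally show "d (D i) (L r) \<le> q + e" using n by simp
      qed
    qed
    then show ?thesis using True L(1) DS by (simp add: b_def)
  qed (use DS in \<open>simp add: b_def\<close>)
  have ball_meas: "{r. b r \<in> mcball (D i) q} \<in> sets borel" for i q
  proof -
    have "Measurable.pred borel (\<lambda>r. b r \<in> mcball (D i) q)" unfolding ball by measurable
    then show ?thesis by (simp add: pred_def)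
  qed
  have b: "b \<in> borel \<rightarrow>\<^sub>M M"
  proof (rule measurable_sigma_sets[OF T(4)])
    fix U assume "U \<in> {U. openin T U}"
    then have U: "openin mtopology U" using S(3) by simp
    \<comment> \<open>The closed balls inside \<open>U\<close> with centre in the dense sequence and
      radius a power of 1/2. There are countably many of them, and they exhaust
      \<open>U\<close>.\<close>
    define I where "I = {p. mcball (D (fst p)) (?h (snd p)) \<subseteq> U}"
    have "\<exists>p\<in>I. x \<in> mcball (D (fst p)) (?h (snd p))" if xU: "x \<in> U" for x
    proof -
      have x: "x \<in> S" using xU U openin_mtopology by blast
      obtain e where e: "e > 0" "mball x e \<subseteq> U" using xU U unfolding openin_mtopology by blast
      obtain n where n: "?h n < e/2" using h_small[of "e/2"] e by auto
      obtain i where i: "d x (D i) < ?h n" using dense[OF x, of "?h n"] by auto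
      have "mcball (D i) (?h n) \<subseteq> mball x e"
      proof
        fix y assume y: "y \<in> mcball (D i) (?h n)"
        then have "y \<in> S" by auto
        then show "y \<in> mball x e"
          using triangle[OF x DS[of i] \<open>y \<in> S\<close>] y n i x by (simp add: in_mball)
      qed
      then have "(i, n) \<in> I" using e by (auto simp: I_def)
      moreover have "x \<in> mcball (D i) (?h n)" using i x DS by (simp add: commute)
      ultimately show ?thesis by (intro bexI[of _ "(i, n)"]) simp_all
    qed
    then have "U = (\<Union>p\<in>I. mcball (D (fst p)) (?h (snd p)))" by (fastforce simp: I_def)
    then have "b -` U \<inter> space borel = (\<Union>p\<in>I. {r. b r \<in> mcball (D (fst p)) (?h (snd p))})"
      by (simp add: vimage_def Collect_bex_eq)
    moreover have "\<dots> \<in> sets borel" by (intro sets.countable_UN'' ball_meas) auto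
    ultimately show "b -` U \<inter> space borel \<in> sets borel" by metis
  next
    show "{U. openin T U} \<subseteq> Pow (topspace T)" using openin_subset by auto
  qed (use bS S(3) in auto)
  from s b bs show thesis by (intro that) auto
qed

text \<open>The retraction \<open>b\<close> is a random element of \<open>qbs_of M\<close>, so
  \<open>\<alpha> \<circ> b\<close> is one of \<open>X\<close> and pulls \<open>U\<close> back to a
  Borel set. Pulling that back along the section \<open>s\<close> gives the preimage under \<alpha>.
  The empty space admits no map from the line and is treated apart.\<close>

lemma qbs_morphisms_standard_borel_measurable:
  fixes M :: "'b measure"
  assumes M: "standard_borel M" and \<alpha>: "\<alpha> \<in> qbs_morphisms (qbs_of M) X"
  shows "\<alpha> \<in> M \<rightarrow>\<^sub>M qbs_algebra X"
proof (rule measurableI)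
  fix U assume "U \<in> sets (qbs_algebra X)"
  then have U: "U \<in> qbs_sets X" by simp
  show "\<alpha> -` U \<inter> space M \<in> sets M"
  proof (cases "space M = {}")
    case False
    obtain s :: "'b \<Rightarrow> real" and b where sb: "s \<in> borel_measurable M" "b \<in> borel \<rightarrow>\<^sub>M M"
        "\<forall>x\<in>space M. b (s x) = x"
      by (rule standard_borel_real_retract[OF M False]) (rule that)
    have "\<alpha> \<circ> b \<in> qbs_random X" using \<alpha> sb(2) by (simp add: qbs_morphisms_def)
    then have "(\<alpha> \<circ> b) -` U \<in> sets borel" using U by (simp add: qbs_sets_def)
    then have "s -` ((\<alpha> \<circ> b) -` U) \<inter> space M \<in> sets M" using sb(1) by (rule measurable_sets[rotated])
    moreover have "s -` ((\<alpha> \<circ> b) -` U) \<inter> space M = \<alpha> -` U \<inter> space M" using sb(3) by auto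
    ultimately show ?thesis by simp
  qed simp
qed (use \<alpha> in \<open>auto simp: qbs_morphisms_def\<close>)

section \<open>Restrictions and densities of s-finite measures\<close>

lemma s_finite_measure_distr:
  assumes "s_finite_measure M" and f[measurable]: "f \<in> M \<rightarrow>\<^sub>M N"
  shows "s_finite_measure (distr M N f)"
proof -
  obtain F :: "nat \<Rightarrow> 'a measure" where
    F: "\<And>i. sets (F i) = sets M" "\<And>i. finite_measure (F i)"
      "\<And>A. A \<in> sets M \<Longrightarrow> emeasure M A = (\<Sum>i. emeasure (F i) A)"
    using assms(1) unfolding s_finite_measure_def by blast
  have Ff: "f \<in> F i \<rightarrow>\<^sub>M N" for i using f measurable_cong_sets[OF F(1) refl] by blast
  have sp: "space (F i) = space M" for i using F(1) by (rule sets_eq_imp_space_eq)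
  have "emeasure (distr M N f) A = (\<Sum>i. emeasure (distr (F i) N f) A)" if "A \<in> sets N" for A
    using that by (simp add: emeasure_distr f Ff F(3) sp)
  then show ?thesis
    unfolding s_finite_measure_def
    by (intro exI[of _ "\<lambda>i. distr (F i) N f"])
       (auto intro: finite_measure.finite_measure_distr F Ff)
qed

lemma s_finite_measure_restricted:
  assumes "s_finite_measure M" and A: "A \<in> sets M"
  shows "s_finite_measure (density M (indicator A))"
proof -
  obtain F :: "nat \<Rightarrow> 'a measure" where
    F: "\<And>i. sets (F i) = sets M" "\<And>i. finite_measure (F i)"
      "\<And>A. A \<in> sets M \<Longrightarrow> emeasure M A = (\<Sum>i. emeasure (F i) A)"
    using assms(1) unfolding s_finite_measure_def by blast
  have "emeasure (density M (indicator A)) E = (\<Sum>i. emeasure (density (F i) (indicator A)) E)"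
    if "E \<in> sets M" for E
    using that A by (simp add: emeasure_restricted F)
  then show ?thesis
    unfolding s_finite_measure_def using A
    by (intro exI[of _ "\<lambda>i. density (F i) (indicator A)"])
       (auto intro: finite_measure.finite_measure_restricted F simp: F(1))
qed

lemma s_finite_measure_qbs_measures:
  assumes "m \<in> qbs_measures X"
  shows "s_finite_measure m"
  using assms
  by (auto simp: qbs_measures_def
      intro!: s_finite_measure_distr qbs_morphisms_standard_borel_measurable)

text \<open>Restricting a pushforward along \<alpha> to \<open>A\<close> is the same as first
  restricting to the preimage of \<open>A\<close> and then pushing forward. The restricted measure
  has the same underlying measurable space, so \<alpha> is still a morphism.\<close>

lemma qbs_measures_restricted:
  assumes "m \<in> qbs_measures X" and A: "A \<in> qbs_sets X"
  shows "density m (indicator A) \<in> qbs_measures X"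
proof -
  obtain M :: "real measure" and \<alpha> where m: "m = distr M (qbs_algebra X) \<alpha>"
    and M: "standard_borel M" "s_finite_measure M" "\<alpha> \<in> qbs_morphisms (qbs_of M) X"
    using assms(1) by (auto simp: qbs_measures_def)
  have \<alpha>: "\<alpha> \<in> M \<rightarrow>\<^sub>M qbs_algebra X"
    using M by (intro qbs_morphisms_standard_borel_measurable)
  define B where "B = \<alpha> -` A \<inter> space M"
  have B: "B \<in> sets M" unfolding B_def using \<alpha> A by (intro measurable_sets) auto
  let ?N = "density M (indicator B)"
  have "density m (indicator A) = distr ?N (qbs_algebra X) \<alpha>"
  proof (rule measure_eqI)
    fix E assume "E \<in> sets (density m (indicator A))"
    then have E: "E \<in> qbs_sets X" by (simp add: m)
    then have "A \<inter> E \<in> qbs_sets X" using sets.Int[of A "qbs_algebra X" E] A by simp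
    moreover have "\<alpha> -` E \<inter> space M \<in> sets M" using \<alpha> E by (intro measurable_sets) auto
    moreover have "\<alpha> -` (A \<inter> E) \<inter> space M = B \<inter> (\<alpha> -` E \<inter> space M)" by (auto simp: B_def)
    ultimately show "emeasure (density m (indicator A)) E = emeasure (distr ?N (qbs_algebra X) \<alpha>) E"
      using A B E \<alpha> by (simp add: m emeasure_restricted emeasure_distr)
  qed (simp add: m)
  moreover have "standard_borel ?N" using M(1) by (simp add: standard_borel_def)
  moreover have "s_finite_measure ?N" by (intro s_finite_measure_restricted M B)
  moreover have "qbs_of ?N = qbs_of M"
    unfolding qbs_of_def by (simp add: measurable_cong_sets[OF refl sets_density])
  ultimately show ?thesis
    using M(3) unfolding qbs_measures_def mem_Collect_eq by (metis (no_types))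
qed

section \<open>Domination by a finite measure, and densities\<close>

lemma finite_measures_dominated:
  fixes F :: "nat \<Rightarrow> 'a measure"
  assumes F: "\<And>i. sets (F i) = sets M" "\<And>i. finite_measure (F i)"
  obtains R where "sets R = sets M" "finite_measure R" "\<forall>i. absolutely_continuous R (F i)"
proof -
  \<comment> \<open>The weights are positive, so that a null set of the weighted sum is null for
    every \<open>F i\<close>, and small enough for the total mass to be at most 1. Adding 1 in the
    denominator covers the case that \<open>F i\<close> is zero.\<close>
  define c :: "nat \<Rightarrow> ennreal" where
    "c i = ennreal ((1/2) ^ Suc i / (1 + measure (F i) (space M)))" for i
  define \<rho> where "\<rho> A = (\<Sum>i. c i * emeasure (F i) A)" for A
  define R where "R = measure_of (space M) (sets M) \<rho>"
  have R: "emeasure R A = \<rho> A" if "A \<in> sets M" for A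
    unfolding R_def
  proof (rule emeasure_measure_of_sigma)
    show "positive (sets M) \<rho>" by (simp add: positive_def \<rho>_def)
    show "countably_additive (sets M) \<rho>"
    proof (rule countably_additiveI)
      fix A :: "nat \<Rightarrow> 'a set" assume A: "range A \<subseteq> sets M" "disjoint_family A"
      \<comment> \<open>The two series are exchanged by reading one of them as an integral for the
        counting measure.\<close>
      have "(\<Sum>j. \<rho> (A j)) = (\<Sum>i. \<Sum>j. c i * emeasure (F i) (A j))"
        unfolding \<rho>_def nn_integral_count_space_nat[symmetric]
        by (subst nn_integral_count_space_nat, subst nn_integral_suminf[symmetric])
           (auto simp: nn_integral_count_space_nat)
      also have "\<dots> = \<rho> (\<Union>j. A j)"
        using A F(1) by (simp add: \<rho>_def suminf_emeasure)
      finally show "(\<Sum>j. \<rho> (A j)) = \<rho> (\<Union>j. A j)" .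
    qed
  qed (use that sets.sigma_algebra_axioms in auto)
  have "finite_measure R"
  proof
    have "c i * emeasure (F i) (space M) \<le> ennreal ((1/2) ^ Suc i)" for i
    proof -
      interpret finite_measure "F i" by (rule F)
      have "(1/2) ^ Suc i / (1 + measure (F i) (space M)) * measure (F i) (space M) \<le> (1/2) ^ Suc i"
        by (simp add: field_simps add_pos_nonneg)
      then show ?thesis
        by (simp add: c_def emeasure_eq_measure ennreal_mult'[symmetric] del: power_Suc)
    qed
    then have "\<rho> (space M) \<le> (\<Sum>i. ennreal ((1/2) ^ Suc i))"
      unfolding \<rho>_def by (intro suminf_le) auto
    also have "\<dots> = ennreal 1"
      by (intro suminf_ennreal_eq power_half_series) auto
    finally have "emeasure R (space M) < \<infinity>" using R[of "space M"]
      by (simp add: order_le_less_trans)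
    then show "emeasure R (space R) \<noteq> \<infinity>" by (simp add: R_def)
  qed
  moreover have "absolutely_continuous R (F i)" for i
    unfolding absolutely_continuous_def
  proof
    fix N assume "N \<in> null_sets R"
    then have N: "N \<in> sets M" "\<rho> N = 0" using R by (auto simp: null_sets_def R_def)
    have "c i > 0" by (auto simp: c_def intro!: divide_pos_pos add_pos_nonneg)
    moreover have "c i * emeasure (F i) N = 0"
      using N(2) suminf_eq_zero_iff[of "\<lambda>i. c i * emeasure (F i) N"] by (auto simp: \<rho>_def)
    ultimately show "N \<in> null_sets (F i)" using N(1) F(1) by (auto simp: null_sets_def)
  qed
  moreover have "sets R = sets M" by (simp add: R_def)
  ultimately show thesis using that by blast
qed

text \<open>A measure that dominates all finite summands of \<open>m\<close> and \<open>n\<close>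
  dominates both sums. The Radon-Nikodym theorem asks for \<sigma>-finiteness of the dominating
  measure only, at the price of densities that may take the value
  \<open>\<infinity>\<close>.\<close>

lemma s_finite_measures_densities:
  assumes "s_finite_measure m" "s_finite_measure n" and sets_eq: "sets m = sets n"
  obtains R and f g :: "'a \<Rightarrow> ennreal"
  where "finite_measure R" "sets R = sets n" "f \<in> borel_measurable R" "g \<in> borel_measurable R"
    "m = density R f" "n = density R g"
proof -
  obtain F :: "nat \<Rightarrow> 'a measure" where
    F: "\<And>i. sets (F i) = sets m" "\<And>i. finite_measure (F i)"
      "\<And>A. A \<in> sets m \<Longrightarrow> emeasure m A = (\<Sum>i. emeasure (F i) A)"
    using assms(1) unfolding s_finite_measure_def by blast
  obtain G :: "nat \<Rightarrow> 'a measure" where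
    G: "\<And>i. sets (G i) = sets n" "\<And>i. finite_measure (G i)"
      "\<And>A. A \<in> sets n \<Longrightarrow> emeasure n A = (\<Sum>i. emeasure (G i) A)"
    using assms(2) unfolding s_finite_measure_def by blast
  \<comment> \<open>The two sequences are interleaved, so that a single dominating measure serves
    both.\<close>
  define H where "H i = (if even i then F (i div 2) else G (i div 2))" for i
  obtain R where R: "sets R = sets n" "finite_measure R" "\<forall>i. absolutely_continuous R (H i)"
  proof (rule finite_measures_dominated)
    show "sets (H i) = sets n" "finite_measure (H i)" for i
      using F(1,2) G(1,2) sets_eq by (simp_all add: H_def)
  qed
  interpret finite_measure R by fact
  have H: "N \<in> null_sets (H i)" if "N \<in> null_sets R" for N i
    using R(3) that by (auto simp: absolutely_continuous_def)
  have "absolutely_continuous R m"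
    unfolding absolutely_continuous_def
  proof
    fix N assume N: "N \<in> null_sets R"
    then have "N \<in> null_sets (F i)" for i using H[OF N, of "2 * i"] by (simp add: H_def)
    then show "N \<in> null_sets m" using F(1,3) by (auto simp: null_sets_def)
  qed
  then obtain f where f: "f \<in> borel_measurable R" "density R f = m"
    using Radon_Nikodym[of m] R(1) sets_eq by auto
  have "absolutely_continuous R n"
    unfolding absolutely_continuous_def
  proof
    fix N assume N: "N \<in> null_sets R"
    then have "N \<in> null_sets (G i)" for i using H[OF N, of "Suc (2 * i)"] by (simp add: H_def)
    then show "N \<in> null_sets n" using G(1,3) by (auto simp: null_sets_def)
  qed
  then obtain g where "g \<in> borel_measurable R" "density R g = n"
    using Radon_Nikodym[of n] R(1) by auto
  with f R that show thesis by blast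
qed

section \<open>The decomposition\<close>

lemma emeasure_finite_density_zero_inf_set:
  assumes "finite_measure R" and f[measurable]: "f \<in> borel_measurable R"
    and U: "zero_inf_set (density R f) U" "\<And>x. x \<in> U \<Longrightarrow> f x < \<infinity>"
  shows "emeasure (density R f) U = 0"
proof -
  interpret finite_measure R by fact
  have UR[measurable]: "U \<in> sets R" using U(1) by (simp add: zero_inf_set_def)
  \<comment> \<open>\<open>U\<close> is exhausted by the sets where the density is at most
    \<open>n\<close>. Each has finite measure because \<open>R\<close> is finite, hence measure 0 as
    a subset of a 0-infinity-set.\<close>
  define V where "V n = {x \<in> space R. x \<in> U \<and> f x \<le> of_nat n}" for n :: nat
  have V[measurable]: "V n \<in> sets R" for n unfolding V_def by measurable
  have "V n \<in> null_sets (density R f)" for n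
  proof -
    have "emeasure (density R f) (V n) = (\<integral>\<^sup>+x. f x * indicator (V n) x \<partial>R)"
      by (simp add: emeasure_density)
    also have "\<dots> \<le> (\<integral>\<^sup>+x. of_nat n \<partial>R)"
      by (intro nn_integral_mono) (auto simp: V_def indicator_def)
    also have "\<dots> < \<infinity>"
      by (simp add: ennreal_mult_eq_top_iff emeasure_eq_measure less_top[symmetric])
    finally have "emeasure (density R f) (V n) \<noteq> \<infinity>" by simp
    moreover have "emeasure (density R f) (V n) \<in> {0, \<infinity>}"
      using U(1) V[of n] unfolding zero_inf_set_def by (simp add: V_def Collect_mono subset_eq)
    ultimately show ?thesis by (simp add: null_sets_def)
  qed
  then have "(\<Union>n. V n) \<in> null_sets (density R f)" by (rule null_sets_UN)
  moreover have "(\<Union>n. V n) = U"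
  proof -
    have "\<exists>n :: nat. f x \<le> of_nat n" if "x \<in> U" for x
    proof -
      have "f x \<noteq> top" using U(2)[OF that] by simp
      then obtain n :: nat where "f x < of_nat n" using ennreal_Ex_less_of_nat by (auto simp: less_top)
      then show ?thesis by (auto intro: less_imp_le)
    qed
    then show ?thesis using sets.sets_into_space[OF UR] by (auto simp: V_def)
  qed
  ultimately show ?thesis by (simp add: null_sets_def)
qed

text \<open>Only the points of density \<open>\<infinity>\<close> contribute to the measure of a
  subset, which is therefore \<open>\<infinity>\<close> times their
  \<open>R\<close>-measure.\<close>

lemma zero_inf_set_density:
  assumes [measurable]: "f \<in> borel_measurable R" and U[measurable]: "U \<in> sets R"
    and f: "AE x in R. x \<in> U \<longrightarrow> f x \<in> {0, \<infinity>}"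
  shows "zero_inf_set (density R f) U"
  unfolding zero_inf_set_def
proof (intro conjI ballI impI)
  fix V assume "V \<in> sets (density R f)" and VU: "V \<subseteq> U"
  then have [measurable]: "V \<in> sets R" by simp
  let ?W = "{x \<in> space R. x \<in> V \<and> f x = \<infinity>}"
  have "emeasure (density R f) V = (\<integral>\<^sup>+x. f x * indicator V x \<partial>R)"
    by (simp add: emeasure_density)
  also have "\<dots> = (\<integral>\<^sup>+x. \<infinity> * indicator ?W x \<partial>R)"
    using f VU by (intro nn_integral_cong_AE) (auto simp: indicator_def elim!: eventually_mono)
  also have "\<dots> = \<infinity> * emeasure R ?W" by (rule nn_integral_cmult_indicator) measurable
  also have "\<dots> \<in> {0, \<infinity>}" by (simp add: ennreal_top_mult)
  finally show "emeasure (density R f) V \<in> {0, \<infinity>}" .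
qed simp

section \<open>Existence for measures with densities\<close>

lemma zero_inf_set_subset:
  "zero_inf_set m U \<Longrightarrow> V \<in> sets m \<Longrightarrow> V \<subseteq> U \<Longrightarrow> zero_inf_set m V"
  unfolding zero_inf_set_def by blast

lemma mutually_singular_restricted:
  assumes "A \<in> sets m" "B \<in> sets m" "A \<inter> B = {}"
  shows "mutually_singular (density m (indicator A)) (density m (indicator B))"
  unfolding mutually_singular_def
  using assms by (intro bexI[of _ A]) (auto simp: emeasure_restricted Int_commute Diff_eq)

text \<open>The 0-infinity-sets of \<open>n\<close> lie, up to \<open>R\<close>-null sets, where
  \<open>g\<close> is 0 or \<open>\<infinity>\<close>. Once \<open>S\<close> is removed,
  \<open>g = \<infinity>\<close> remains. There \<open>m\<close> has 0-infinity-sets for free where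
  \<open>f\<close> is 0 or \<open>\<infinity>\<close>, and only trivial ones where \<open>f\<close>
  is positive and finite, which is the cell \<open>I\<close>.\<close>

lemma density_decomposition:
  fixes R :: "'a measure" and f g :: "'a \<Rightarrow> ennreal"
  assumes "finite_measure R"
    and [measurable]: "f \<in> borel_measurable R" "g \<in> borel_measurable R"
  defines "m \<equiv> density R f" and "n \<equiv> density R g"
  defines "S \<equiv> {x \<in> space R. g x = 0}"
    and "I \<equiv> {x \<in> space R. g x = \<infinity> \<and> f x \<noteq> 0 \<and> f x \<noteq> \<infinity>}"
  shows "inf_absolutely_continuous (density m (indicator (space R - S - I))) n"
    and "inf_singular (density m (indicator I)) n"
    and "mutually_singular (density m (indicator S)) n"
proof -
  have [measurable]: "S \<in> sets R" "I \<in> sets R" unfolding S_def I_def by measurable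
  have sets [simp]: "sets m = sets R" "sets n = sets R" "space m = space R"
    by (simp_all add: m_def n_def)
  have abs: "absolutely_continuous n (density m (indicator B))"
    if [measurable]: "B \<in> sets R" and B: "B \<inter> S = {}" for B
    unfolding absolutely_continuous_def
  proof
    fix N assume "N \<in> null_sets n"
    then have [measurable]: "N \<in> sets R" and N: "AE x in R. x \<in> N \<longrightarrow> g x = 0"
      by (simp_all add: n_def null_sets_density_iff)
    \<comment> \<open>Almost every point satisfies this vacuously: \<open>g\<close> vanishes almost
      everywhere on \<open>N\<close>, whereas \<open>B\<close> avoids the zeros of
      \<open>g\<close>.\<close>
    have "AE x in R. x \<in> B \<inter> N \<longrightarrow> f x = 0"
      using N AE_space by eventually_elim (use B in \<open>auto simp: S_def\<close>)
    then have "B \<inter> N \<in> null_sets m" by (simp add: m_def null_sets_density_iff)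
    then show "N \<in> null_sets (density m (indicator B))"
      by (simp add: null_sets_def emeasure_restricted)
  qed
  show "inf_absolutely_continuous (density m (indicator (space R - S - I))) n"
    unfolding inf_absolutely_continuous_def
  proof (intro conjI allI impI abs)
    let ?A = "space R - S - I"
    fix U assume U: "zero_inf_set n U"
    then have [measurable]: "U \<in> sets R" by (simp add: zero_inf_set_def)
    \<comment> \<open>The part of \<open>U\<close> with finite \<open>g\<close> is
      \<open>n\<close>-null, so almost all of it lies in \<open>S\<close>. Hence almost everywhere
      on the rest of \<open>U\<close> one has \<open>g = \<infinity>\<close>, and outside
      \<open>I\<close> this leaves only the values 0 and \<open>\<infinity>\<close> for
      \<open>f\<close>.\<close>
    define W where "W = {x \<in> space R. x \<in> U \<and> g x < \<infinity>}"
    have W [measurable]: "W \<in> sets R" unfolding W_def by measurable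
    have "zero_inf_set n W" by (rule zero_inf_set_subset[OF U]) (auto simp: W_def)
    then have "emeasure n W = 0"
      unfolding n_def
      by (rule emeasure_finite_density_zero_inf_set[OF assms(1,3)]) (simp add: W_def)
    then have "W \<in> null_sets n" by (simp add: null_sets_def)
    then have "AE x in R. x \<in> W \<longrightarrow> g x = 0" by (simp add: n_def null_sets_density_iff)
    then have "AE x in R. x \<in> U \<inter> ?A \<longrightarrow> f x \<in> {0, \<infinity>}"
      using AE_space by eventually_elim (auto simp: W_def S_def I_def less_top)
    then have Z: "zero_inf_set m (U \<inter> ?A)" unfolding m_def by (intro zero_inf_set_density) auto
    show "zero_inf_set (density m (indicator ?A)) U"
      unfolding zero_inf_set_def
    proof (intro conjI ballI impI)
      fix V assume "V \<in> sets (density m (indicator ?A))" "V \<subseteq> U"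
      then have "V \<in> sets R" "?A \<inter> V \<subseteq> U \<inter> ?A" by auto
      then show "emeasure (density m (indicator ?A)) V \<in> {0, \<infinity>}"
        using Z unfolding zero_inf_set_def by (auto simp: emeasure_restricted)
    qed simp
  qed auto
  show "inf_singular (density m (indicator I)) n"
    unfolding inf_singular_def
  proof (intro conjI allI impI abs bexI[of _ I])
    show "I \<inter> S = {}" by (auto simp: I_def S_def)
    fix U assume U: "zero_inf_set (density m (indicator I)) U"
    then have UR [measurable]: "U \<in> sets R" by (simp add: zero_inf_set_def)
    \<comment> \<open>Inside \<open>I\<close> the restricted measure agrees with \<open>m\<close>,
      and the density \<open>f\<close> is finite there.\<close>
    have "zero_inf_set m (I \<inter> U)"
      unfolding zero_inf_set_def
    proof (intro conjI ballI impI)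
      fix V assume "V \<in> sets m" "V \<subseteq> I \<inter> U"
      moreover from this have "I \<inter> V = V" by auto
      ultimately show "emeasure m V \<in> {0, \<infinity>}"
        using U unfolding zero_inf_set_def by (auto simp: emeasure_restricted)
    qed simp
    then have "emeasure m (I \<inter> U) = 0"
      unfolding m_def
      by (rule emeasure_finite_density_zero_inf_set[OF assms(1,2)]) (simp add: I_def less_top)
    then show "emeasure (density m (indicator I)) U = 0" by (simp add: emeasure_restricted)
  next
    have "I \<inter> (space R - I) = {}" by auto
    then show "emeasure (density m (indicator I)) (space (density m (indicator I)) - I) = 0"
      by (simp add: emeasure_restricted)
    show "zero_inf_set n I"
      unfolding n_def by (intro zero_inf_set_density) (auto simp: I_def)
  qed auto
  show "mutually_singular (density m (indicator S)) n"
    unfolding mutually_singular_def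
  proof (intro bexI[of _ S] conjI)
    have "S \<inter> (space R - S) = {}" by auto
    then show "emeasure (density m (indicator S)) (space (density m (indicator S)) - S) = 0"
      by (simp add: emeasure_restricted)
    have "S \<in> null_sets n" by (simp add: n_def null_sets_density_iff) (simp add: S_def)
    then show "emeasure n S = 0" by (rule null_setsD1)
  qed simp
qed

section \<open>Uniqueness of the decomposition\<close>

locale inf_decomposition =
  fixes m n a i s :: "'a measure"
  assumes sets_eq: "sets n = sets m" "sets a = sets m" "sets i = sets m" "sets s = sets m"
    and sum: "\<And>E. E \<in> sets m \<Longrightarrow> emeasure m E = emeasure a E + emeasure i E + emeasure s E"
    and singular: "mutually_singular a i"
    and a: "inf_absolutely_continuous a n"
    and i: "inf_singular i n"
    and s: "mutually_singular s n"
begin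

lemma space_eq: "space a = space m" "space i = space m" "space s = space m" "space n = space m"
  using sets_eq by (auto dest: sets_eq_imp_space_eq)

text \<open>Each component is the restriction of \<open>m\<close> to a cell of a partition. Two
  decompositions can thus be compared through their cells, up to \<open>m\<close>-null sets.\<close>

lemma carriers:
  obtains S I where "S \<in> sets m" "I \<in> sets m" "S \<inter> I = {}" "emeasure n S = 0" "zero_inf_set n I"
    "\<And>E. E \<in> sets m \<Longrightarrow> emeasure s E = emeasure m (E \<inter> S)"
    "\<And>E. E \<in> sets m \<Longrightarrow> emeasure i E = emeasure m (E \<inter> I)"
    "\<And>E. E \<in> sets m \<Longrightarrow> emeasure a E = emeasure m (E - S - I)"
proof -
  obtain S where S [measurable]: "S \<in> sets m" and sS: "emeasure s (space m - S) = 0"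
    and nS: "emeasure n S = 0"
    using s unfolding mutually_singular_def by (auto simp: sets_eq space_eq)
  obtain B where B [measurable]: "B \<in> sets m" and aB: "emeasure a (space m - B) = 0"
    and iB: "emeasure i B = 0"
    using singular unfolding mutually_singular_def by (auto simp: sets_eq space_eq)
  obtain C where C [measurable]: "C \<in> sets m" and iC: "emeasure i (space m - C) = 0"
    and nC: "zero_inf_set n C"
    using i unfolding inf_singular_def by (auto simp: sets_eq space_eq)
  have S_null: "S \<in> null_sets n" using nS by (simp add: null_setsI sets_eq)
  then have aS: "S \<in> null_sets a" and iS: "S \<in> null_sets i"
    using a i by (auto simp: inf_absolutely_continuous_def inf_singular_def absolutely_continuous_def)
  \<comment> \<open>\<open>C\<close> carries \<open>i\<close> and is a 0-infinity-set of
    \<open>n\<close>. Removing \<open>B\<close> and \<open>S\<close>, both null for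
    \<open>i\<close>, keeps these properties and makes the set null for \<open>a\<close> and
    \<open>s\<close>.\<close>
  define I where "I = C - B - S"
  have I [measurable]: "I \<in> sets m" by (simp add: I_def)
  have zero: "emeasure q E = 0" if "E \<subseteq> F" "emeasure q F = 0" "E \<in> sets m" "F \<in> sets m" "sets q = sets m"
    for q :: "'a measure" and E F
    using emeasure_mono[OF that(1), of q] that by simp
  have sp: "E \<subseteq> space m" if "E \<in> sets m" for E using that by (rule sets.sets_into_space)
  have aI: "emeasure a I = 0"
    by (rule zero[OF _ aB]) (use sp[OF C] in \<open>auto simp: I_def sets_eq\<close>)
  have sI: "emeasure s I = 0"
    by (rule zero[OF _ sS]) (use sp[OF C] in \<open>auto simp: I_def sets_eq\<close>)
  have "(space m - C) \<union> (B \<union> S) \<in> null_sets i"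
    using iC iB iS by (intro null_sets.Un) (auto simp: null_sets_def sets_eq)
  then have "space m - I \<in> null_sets i"
    by (rule null_sets_subset) (simp add: sets_eq, auto simp: I_def)
  then have iI: "emeasure i (space m - I) = 0" by (rule null_setsD1)
  have concentrated: "emeasure q E = emeasure q (E \<inter> F)"
    if "emeasure q (space m - F) = 0" "E \<in> sets m" "F \<in> sets m" "sets q = sets m"
    for q :: "'a measure" and E F
  proof -
    have "emeasure q (E - F) = 0"
      by (rule zero[OF _ that(1)]) (use sp[OF that(2)] that in auto)
    then show ?thesis
      using emeasure_Un_null_set[of "E \<inter> F" q "E - F"] that by (simp add: null_sets_def Int_Diff_Un)
  qed
  have inS: "emeasure s E = emeasure m (E \<inter> S)" if [measurable]: "E \<in> sets m" for E
  proof -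
    have "emeasure a (E \<inter> S) = 0" by (rule zero[of _ S]) (use aS in \<open>auto simp: sets_eq\<close>)
    moreover have "emeasure i (E \<inter> S) = 0" by (rule zero[of _ S]) (use iS in \<open>auto simp: sets_eq\<close>)
    ultimately show ?thesis using concentrated[OF sS that] sum[of "E \<inter> S"] by (simp add: sets_eq)
  qed
  have inI: "emeasure i E = emeasure m (E \<inter> I)" if [measurable]: "E \<in> sets m" for E
  proof -
    have "emeasure a (E \<inter> I) = 0" by (rule zero[OF _ aI]) (auto simp: sets_eq)
    moreover have "emeasure s (E \<inter> I) = 0" by (rule zero[OF _ sI]) (auto simp: sets_eq)
    ultimately show ?thesis using concentrated[OF iI that] sum[of "E \<inter> I"] by (simp add: sets_eq)
  qed
  have inA: "emeasure a E = emeasure m (E - S - I)" if [measurable]: "E \<in> sets m" for E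
  proof -
    have "emeasure s (E - S - I) = 0"
      by (rule zero[OF _ sS]) (use sp[OF that] in \<open>auto simp: sets_eq\<close>)
    moreover have "emeasure i (E - S - I) = 0"
      by (rule zero[OF _ iI]) (use sp[OF that] in \<open>auto simp: sets_eq\<close>)
    moreover have "E - S - I = E - (S \<union> I)" by auto
    ultimately have "emeasure m (E - S - I) = emeasure a (E - (S \<union> I))"
      using sum[of "E - S - I"] by simp
    moreover have "S \<union> I \<in> null_sets a"
      using aS aI by (intro null_sets.Un) (auto simp: null_sets_def sets_eq)
    ultimately show ?thesis by (simp add: emeasure_Diff_null_set sets_eq)
  qed
  have "zero_inf_set n I" by (rule zero_inf_set_subset[OF nC]) (auto simp: I_def sets_eq)
  moreover have "S \<inter> I = {}" by (auto simp: I_def)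
  ultimately show thesis using S I nS inS inI inA by (intro that)
qed

text \<open>Since \<open>a\<close> and \<open>i\<close> are absolutely continuous with respect to
  \<open>n\<close>, only \<open>s\<close> could charge an \<open>n\<close>-null set. This is what
  identifies the carriers of the singular components.\<close>

lemma null_if_null_singular:
  assumes [measurable]: "D \<in> sets m" and "emeasure n D = 0" "emeasure s D = 0"
  shows "D \<in> null_sets m"
proof -
  have "D \<in> null_sets n" using assms by (intro null_setsI) (auto simp: sets_eq)
  then have "D \<in> null_sets a" "D \<in> null_sets i"
    using a i by (auto simp: inf_absolutely_continuous_def inf_singular_def absolutely_continuous_def)
  then show ?thesis using sum[of D] assms by (intro null_setsI) auto
qed

text \<open>Meant for \<open>q\<close> the infinity-singular component of another decomposition and
  \<open>D\<close> a difference of the two carriers. On \<open>D\<close> the measures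
  \<open>m\<close>, \<open>a\<close> and \<open>q\<close> coincide; \<open>a\<close> inherits the
  0-infinity-set \<open>D\<close> from \<open>n\<close>, while \<open>q\<close> has only trivial
  ones.\<close>

lemma null_if_inf_singular:
  assumes [measurable]: "D \<in> sets m" and D: "zero_inf_set n D" "emeasure i D = 0" "emeasure s D = 0"
    and q: "inf_singular q n" "sets q = sets m" "\<And>E. E \<in> sets m \<Longrightarrow> E \<subseteq> D \<Longrightarrow> emeasure q E = emeasure m E"
  shows "D \<in> null_sets m"
proof -
  have aD: "zero_inf_set a D" using D(1) a by (simp add: inf_absolutely_continuous_def)
  have "emeasure m E = emeasure a E" if "E \<in> sets m" "E \<subseteq> D" for E
  proof -
    have "emeasure i E = 0" "emeasure s E = 0"
      using emeasure_mono[OF that(2), of i] emeasure_mono[OF that(2), of s] D assms(1)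
      by (simp_all add: sets_eq)
    then show ?thesis using sum[OF that(1)] by simp
  qed
  then have "zero_inf_set q D" using aD q(2,3) unfolding zero_inf_set_def by (auto simp: sets_eq)
  then have "emeasure q D = 0" using q(1) by (simp add: inf_singular_def)
  then show ?thesis using q(3)[of D] by (intro null_setsI) auto
qed

end

lemma inf_decomposition_unique:
  assumes "inf_decomposition m n a i s" "inf_decomposition m n a' i' s'"
  shows "a = a'" "i = i'" "s = s'"
proof -
  interpret D: inf_decomposition m n a i s by fact
  interpret D': inf_decomposition m n a' i' s' by fact
  obtain S I where SI [measurable]: "S \<in> sets m" "I \<in> sets m" and disj: "S \<inter> I = {}"
    and n: "emeasure n S = 0" "zero_inf_set n I"
    and s: "\<And>E. E \<in> sets m \<Longrightarrow> emeasure s E = emeasure m (E \<inter> S)"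
    and i: "\<And>E. E \<in> sets m \<Longrightarrow> emeasure i E = emeasure m (E \<inter> I)"
    and a: "\<And>E. E \<in> sets m \<Longrightarrow> emeasure a E = emeasure m (E - S - I)"
    by (rule D.carriers) (rule that)
  obtain S' I' where SI' [measurable]: "S' \<in> sets m" "I' \<in> sets m" and disj': "S' \<inter> I' = {}"
    and n': "emeasure n S' = 0" "zero_inf_set n I'"
    and s': "\<And>E. E \<in> sets m \<Longrightarrow> emeasure s' E = emeasure m (E \<inter> S')"
    and i': "\<And>E. E \<in> sets m \<Longrightarrow> emeasure i' E = emeasure m (E \<inter> I')"
    and a': "\<And>E. E \<in> sets m \<Longrightarrow> emeasure a' E = emeasure m (E - S' - I')"
    by (rule D'.carriers) (rule that)
  have n_null: "emeasure n (E - F) = 0" if "emeasure n E = 0" "E \<in> sets m" "F \<in> sets m" for E F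
    using emeasure_mono[of "E - F" E n] that by (auto simp: D.sets_eq)
  have "(S' - S) \<inter> S = {}" "(S - S') \<inter> S' = {}" by auto
  \<comment> \<open>\<open>S' - S\<close> is \<open>n\<close>-null as a part of \<open>S'\<close>,
    and \<open>s\<close>-null because it misses the carrier \<open>S\<close>; the other difference
    is symmetric.\<close>
  then have S: "S' - S \<in> null_sets m" "S - S' \<in> null_sets m"
    using n(1) n'(1) s[of "S' - S"] s'[of "S - S'"]
    by (simp_all add: D.null_if_null_singular D'.null_if_null_singular n_null)
  have m_null: "emeasure m E = 0" if "E \<subseteq> F" "F \<in> null_sets m" "E \<in> sets m" for E F
    using null_sets_subset[OF that(2,3,1)] by auto
  have "I' - I \<in> null_sets m"
  proof (rule D.null_if_inf_singular[OF _ _ _ _ D'.i])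
    show "zero_inf_set n (I' - I)" by (rule zero_inf_set_subset[OF n'(2)]) (auto simp: D.sets_eq)
    \<comment> \<open>\<open>I'\<close> is disjoint from \<open>S'\<close>, so its part in
      \<open>S\<close> lies in the null set \<open>S - S'\<close>.\<close>
    show "emeasure s (I' - I) = 0"
      using disj' by (subst s) (auto intro!: m_null[OF _ S(2)])
    show "emeasure i' E = emeasure m E" if "E \<in> sets m" "E \<subseteq> I' - I" for E
      using that i'[OF that(1)] by (simp add: Int_absorb2 subset_eq)
  qed (auto simp: i D'.sets_eq Int_commute)
  moreover have "I - I' \<in> null_sets m"
  proof (rule D'.null_if_inf_singular[OF _ _ _ _ D.i])
    show "zero_inf_set n (I - I')" by (rule zero_inf_set_subset[OF n(2)]) (auto simp: D.sets_eq)
    show "emeasure s' (I - I') = 0"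
      using disj by (subst s') (auto intro!: m_null[OF _ S(1)])
    show "emeasure i E = emeasure m E" if "E \<in> sets m" "E \<subseteq> I - I'" for E
      using that i[OF that(1)] by (simp add: Int_absorb2 subset_eq)
  qed (auto simp: i' D.sets_eq Int_commute)
  ultimately have ae: "AE x in m. x \<in> S \<longleftrightarrow> x \<in> S'" "AE x in m. x \<in> I \<longleftrightarrow> x \<in> I'"
    using S[THEN AE_not_in] by (auto dest!: AE_not_in elim!: eventually_elim2)
  show "s = s'"
  proof (rule measure_eqI)
    fix E assume "E \<in> sets s"
    then have [measurable]: "E \<in> sets m" by (simp add: D.sets_eq)
    show "emeasure s E = emeasure s' E"
      unfolding s[OF \<open>E \<in> sets m\<close>] s'[OF \<open>E \<in> sets m\<close>]
      by (rule emeasure_eq_AE) (use ae in \<open>auto elim: eventually_mono\<close>)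
  qed (simp add: D.sets_eq D'.sets_eq)
  show "i = i'"
  proof (rule measure_eqI)
    fix E assume "E \<in> sets i"
    then have [measurable]: "E \<in> sets m" by (simp add: D.sets_eq)
    show "emeasure i E = emeasure i' E"
      unfolding i[OF \<open>E \<in> sets m\<close>] i'[OF \<open>E \<in> sets m\<close>]
      by (rule emeasure_eq_AE) (use ae in \<open>auto elim: eventually_mono\<close>)
  qed (simp add: D.sets_eq D'.sets_eq)
  show "a = a'"
  proof (rule measure_eqI)
    fix E assume "E \<in> sets a"
    then have [measurable]: "E \<in> sets m" by (simp add: D.sets_eq)
    show "emeasure a E = emeasure a' E"
      unfolding a[OF \<open>E \<in> sets m\<close>] a'[OF \<open>E \<in> sets m\<close>]
    proof (rule emeasure_eq_AE)
      show "AE x in m. x \<in> E - S - I \<longleftrightarrow> x \<in> E - S' - I'" using ae by eventually_elim simp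
    qed simp_all
  qed (simp add: D.sets_eq D'.sets_eq)
qed

section \<open>The decomposition in a quasi-Borel space\<close>

theorem theorem22:
  fixes X :: "'a quasi_borel" and \<mu> \<nu> :: "'a measure"
  assumes "\<mu> \<in> qbs_measures X" and "\<nu> \<in> qbs_measures X"
  shows "\<exists>!(\<mu>\<^sub>a, \<mu>\<^sub>i, \<mu>\<^sub>s).
           \<mu>\<^sub>a \<in> qbs_measures X \<and> \<mu>\<^sub>i \<in> qbs_measures X \<and> \<mu>\<^sub>s \<in> qbs_measures X \<and>
           (\<forall>A\<in>sets (qbs_algebra X).
              emeasure \<mu> A = emeasure \<mu>\<^sub>a A + emeasure \<mu>\<^sub>i A + emeasure \<mu>\<^sub>s A) \<and>
           mutually_singular \<mu>\<^sub>a \<mu>\<^sub>i \<and> mutually_singular \<mu>\<^sub>a \<mu>\<^sub>s \<and> mutually_singular \<mu>\<^sub>i \<mu>\<^sub>s \<and>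
           inf_absolutely_continuous \<mu>\<^sub>a \<nu> \<and>
           inf_singular \<mu>\<^sub>i \<nu> \<and>
           mutually_singular \<mu>\<^sub>s \<nu>"
    (is "\<exists>!d. case d of (a, i, s) \<Rightarrow> ?P a i s")
proof -
  have sets: "sets \<mu> = qbs_sets X" "sets \<nu> = qbs_sets X"
    using assms by (auto dest: sets_qbs_measures)
  obtain R and f g :: "'a \<Rightarrow> ennreal" where R: "finite_measure R" "sets R = sets \<nu>"
    and fg [measurable]: "f \<in> borel_measurable R" "g \<in> borel_measurable R"
    and eq: "\<mu> = density R f" "\<nu> = density R g"
    using s_finite_measures_densities[of \<mu> \<nu>] assms sets by (metis s_finite_measure_qbs_measures)
  define S where "S = {x \<in> space R. g x = 0}"
  define I where "I = {x \<in> space R. g x = \<infinity> \<and> f x \<noteq> 0 \<and> f x \<noteq> \<infinity>}"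
  define A where "A = space R - S - I"
  have "S \<in> sets R" "I \<in> sets R" unfolding S_def I_def by measurable
  moreover from this have "A \<in> sets R" by (simp add: A_def)
  ultimately have SI [measurable]: "S \<in> sets \<mu>" "I \<in> sets \<mu>" "A \<in> sets \<mu>"
    using R(2) sets by simp_all
  have disj: "A \<inter> I = {}" "A \<inter> S = {}" "I \<inter> S = {}" by (auto simp: A_def S_def I_def)
  let ?r = "\<lambda>B. density \<mu> (indicator B)"
  note dec = density_decomposition[OF R(1) fg, folded S_def I_def, folded A_def eq]
  have sum: "emeasure \<mu> E = emeasure (?r A) E + emeasure (?r I) E + emeasure (?r S) E"
    if [measurable]: "E \<in> sets \<mu>" for E
  proof -
    have "E \<subseteq> space R" using sets.sets_into_space[OF that] by (simp add: eq)
    then have "E = (A \<inter> E \<union> I \<inter> E) \<union> S \<inter> E" by (auto simp: A_def)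
    moreover have "emeasure \<mu> (A \<inter> E) + emeasure \<mu> (I \<inter> E) = emeasure \<mu> (A \<inter> E \<union> I \<inter> E)"
      using disj by (intro plus_emeasure) auto
    moreover have "emeasure \<mu> (A \<inter> E \<union> I \<inter> E) + emeasure \<mu> (S \<inter> E) =
        emeasure \<mu> ((A \<inter> E \<union> I \<inter> E) \<union> S \<inter> E)"
      using disj by (intro plus_emeasure) auto
    ultimately show ?thesis by (simp add: emeasure_restricted)
  qed
  have exists: "?P (?r A) (?r I) (?r S)"
    using dec sum SI disj assms(1) sets
    by (auto intro!: qbs_measures_restricted mutually_singular_restricted)
  have decomposition: "inf_decomposition \<mu> \<nu> a i s" if "?P a i s" for a i s
    using that sets by unfold_locales (auto dest: sets_qbs_measures)
  show ?thesis
  proof (rule ex1I[of _ "(?r A, ?r I, ?r S)"])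
    fix d assume d: "case d of (a, i, s) \<Rightarrow> ?P a i s"
    obtain a i s where "d = (a, i, s)" by (cases d)
    with d show "d = (?r A, ?r I, ?r S)"
      using inf_decomposition_unique[OF decomposition decomposition[OF exists], of a i s] by simp
  qed (use exists in simp)
qed

end
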